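(* In the symmetric Test and Find model with a random number $K$ of objects (see context), fix $i\in\{1,2,\dots,n\}$ and $s\in\Sigma$ with $P(S=s)>0$, let $x=M(s)=\sum_{j=1}^n(1-s_j)$, and let $\alpha_i(s)=P(T_i=0|S=s)$. If $s_i=0$, then $x\in\{1,2,\dots,n\}$ and $$\alpha_i(s)=\mathrm E[\alpha^-(x,K)|S=s]=\sum_{k=0}^n\alpha^-(x,k)\,\pi_K'(k|s).$$ If $s_i=1$, then $x\in\{0,1,\dots,n-1\}$ and $$\alpha_i(s)=\mathrm E[\alpha^+(x,K)|S=s]=\sum_{k=0}^n\alpha^+(x,k)\,\pi_K'(k|s).$$
   Context: Let $n\ge1$ be an integer, $a,b\in[1/2,1]$, and $\Sigma=\{0,1\}^n$. For $0\le k\le n$ let $\Gamma_{n,k}=\{\gamma\in\{0,1\}^n:\sum_j\gamma_j=k\}$. The number of objects $K$ is a random variable with an arbitrary distribution $\pi'_K$ on $\{0,1,\dots,n\}$. Given $K=k$, the allocation $T=(T_1,\dots,T_n)$ is uniformly distributed on $\Gamma_{n,k}$. The test results $S=(S_1,\dots,S_n)\in\Sigma$ satisfy: conditionally on $T=\gamma$ (so $K=\sum_j\gamma_j$), the $S_i$ are independent with $P(S_i=1|T=\gamma)=a$ if $\gamma_i=1$ and $P(S_i=0|T=\gamma)=b$ if $\gamma_i=0$. $\pi'_K(k|s):=P(K=k|S=s)$ is the posterior distribution of $K$. For integers $n'\ge k\ge0$, $g_{n',k}$ denotes the probability mass function of $N_1+N_2$ where $N_1\sim\mathrm{Bin}(k,1-a)$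 and $N_2\sim\mathrm{Bin}(n'-k,b)$ are independent. Set $$\alpha^-(x,k)=b\,\frac{n-k}{x}\,\frac{g_{n-1,k}(x-1)}{g_{n,k}(x)}\quad(1\le x\le n),\qquad \alpha^+(x,k)=(1-b)\,\frac{n-k}{n-x}\,\frac{g_{n-1,k}(x)}{g_{n,k}(x)}\quad(0\le x\le n-1).$$ Conventions: for $k=n$ these are $0$; if $g_{n,k}(x)=0$ they are set to $0$ (in that case $\pi'_K(k|s)=0$ for every $s$ with $M(s)=x$ and $P(S=s)>0$). *)

theory Defs
  imports "HOL-Probability.Probability"
begin

text \<open>
  Elements of \<open>{0,1}^n\<close> are extensional functions on \<open>{1..n}\<close>, so that equality of
  vectors is equality of functions.
\<close>

definition bit_vectors :: "nat \<Rightarrow> (nat \<Rightarrow> nat) set" where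
  "bit_vectors n = {1..n} \<rightarrow>\<^sub>E {0, 1}"

definition allocations :: "nat \<Rightarrow> nat \<Rightarrow> (nat \<Rightarrow> nat) set" where
  "allocations n k = {\<gamma> \<in> bit_vectors n. (\<Sum>j=1..n. \<gamma> j) = k}"

text \<open>On bit vectors the subtraction never truncates.\<close>

definition num_zeros :: "nat \<Rightarrow> (nat \<Rightarrow> nat) \<Rightarrow> nat" where
  "num_zeros n s = (\<Sum>j=1..n. 1 - s j)"

text \<open>
  The conditional probability space given the event \<open>Q\<close>; only meaningful if \<open>Q\<close> has
  positive probability.
\<close>

abbreviation cond_space :: "'w measure \<Rightarrow> ('w \<Rightarrow> bool) \<Rightarrow> 'w measure" where
  "cond_space M Q \<equiv> uniform_measure M {\<omega> \<in> space M. Q \<omega>}"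

definition cond_expect :: "'w measure \<Rightarrow> ('w \<Rightarrow> real) \<Rightarrow> ('w \<Rightarrow> bool) \<Rightarrow> real" where
  "cond_expect M X Q = (\<integral>\<omega>. X \<omega> \<partial>cond_space M Q)"

text \<open>
  Conditions given \<open>K = k\<close> or \<open>T = \<gamma>\<close> are imposed only where the conditioning event has
  positive probability. The law of \<open>K\<close> on \<open>{0..n}\<close> is unrestricted. The assumption
  \<open>T_given_K\<close> ranges over all bit vectors, so it also says that \<open>T\<close> almost surely has
  exactly \<open>K\<close> ones.
\<close>

locale test_and_find = prob_space M
  for M :: "'w measure" and n :: nat and a b :: real
    and K :: "'w \<Rightarrow> nat" and T S :: "'w \<Rightarrow> nat \<Rightarrow> nat" +
  assumes n_pos: "n \<ge> 1"
    and a_range: "a \<in> {1/2..1}"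
    and b_range: "b \<in> {1/2..1}"
    and K_measurable: "K \<in> M \<rightarrow>\<^sub>M count_space {0..n}"
    and T_measurable: "T \<in> M \<rightarrow>\<^sub>M count_space (bit_vectors n)"
    and S_measurable: "S \<in> M \<rightarrow>\<^sub>M count_space (bit_vectors n)"
    and T_given_K: "\<And>k \<gamma>. \<P>(\<omega> in M. K \<omega> = k) > 0 \<Longrightarrow> \<gamma> \<in> bit_vectors n \<Longrightarrow>
          \<P>(\<omega> in M. T \<omega> = \<gamma> \<bar> K \<omega> = k) = pmf (pmf_of_set (allocations n k)) \<gamma>"
    and S_indep_given_T: "\<And>\<gamma>. \<P>(\<omega> in M. T \<omega> = \<gamma>) > 0 \<Longrightarrow>
          prob_space.indep_vars (cond_space M (\<lambda>\<omega>. T \<omega> = \<gamma>))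
            (\<lambda>_. count_space {0, 1}) (\<lambda>i \<omega>. S \<omega> i) {1..n}"
    and S_one_given_T: "\<And>\<gamma> i. \<P>(\<omega> in M. T \<omega> = \<gamma>) > 0 \<Longrightarrow> i \<in> {1..n} \<Longrightarrow> \<gamma> i = 1 \<Longrightarrow>
          \<P>(\<omega> in M. S \<omega> i = 1 \<bar> T \<omega> = \<gamma>) = a"
    and S_zero_given_T: "\<And>\<gamma> i. \<P>(\<omega> in M. T \<omega> = \<gamma>) > 0 \<Longrightarrow> i \<in> {1..n} \<Longrightarrow> \<gamma> i = 0 \<Longrightarrow>
          \<P>(\<omega> in M. S \<omega> i = 0 \<bar> T \<omega> = \<gamma>) = b"

text \<open>Meaningful for \<open>k \<le> m\<close> and \<open>a, b \<in> {0..1}\<close>.\<close>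

definition zeros_pmf :: "real \<Rightarrow> real \<Rightarrow> nat \<Rightarrow> nat \<Rightarrow> nat pmf" where
  "zeros_pmf a b m k =
     map_pmf (\<lambda>(u, v). u + v) (pair_pmf (binomial_pmf k (1 - a)) (binomial_pmf (m - k) b))"

definition g :: "real \<Rightarrow> real \<Rightarrow> nat \<Rightarrow> nat \<Rightarrow> nat \<Rightarrow> real" where
  "g a b m k x = pmf (zeros_pmf a b m k) x"

definition alpha_minus :: "nat \<Rightarrow> real \<Rightarrow> real \<Rightarrow> nat \<Rightarrow> nat \<Rightarrow> real" where
  "alpha_minus n a b x k =
     (if k = n \<or> g a b n k x = 0 then 0
      else b * ((real n - real k) / real x) * (g a b (n - 1) k (x - 1) / g a b n k x))"

definition alpha_plus :: "nat \<Rightarrow> real \<Rightarrow> real \<Rightarrow> nat \<Rightarrow> nat \<Rightarrow> real" where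
  "alpha_plus n a b x k =
     (if k = n \<or> g a b n k x = 0 then 0
      else (1 - b) * ((real n - real k) / (real n - real x)) * (g a b (n - 1) k x / g a b n k x))"

end

theory Submission
  imports Defs
begin

text \<open>
  Given \<open>K = k\<close>, all allocations in \<open>allocations n k\<close> are equally likely, so by
  Bayes' rule the posterior probability of \<open>T i = 0\<close> given \<open>S = s\<close> and \<open>K
  = k\<close> is a quotient of two sums of likelihoods of \<open>s\<close>: over the allocations
  \<open>\<gamma>\<close> of \<open>k\<close> objects with \<open>\<gamma> i = 0\<close>, and over all
  allocations of \<open>k\<close> objects. The proof shows that this quotient is the stated
  \<open>\<alpha>\<^sup>-(x, k)\<close> or \<open>\<alpha>\<^sup>+(x, k)\<close> and then averages over
  the posterior of \<open>K\<close>.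

  Likelihoods are products over the cells, so their sum over \<open>allocations n k\<close> is the
  coefficient of \<open>z ^ k\<close> in a product of linear polynomials in \<open>z\<close>, one for
  each cell (\<open>sum_allocations_prod_eq_coeff\<close>): the factor is \<open>b + (1 - a) z\<close>
  for a cell tested \<open>0\<close> and \<open>(1 - b) + a z\<close> for a cell tested \<open>1\<close>.
  Hence the sum depends on \<open>s\<close> only through its number \<open>x\<close> of zeros. Likewise
  \<open>g a b n k x\<close> is the coefficient of \<open>y ^ x\<close> in \<open>(a + (1 - a) y) ^ k *
  ((1 - b) + b y) ^ (n - k)\<close>. Summing the likelihood over all pairs of an allocation of
  \<open>k\<close> objects and a test result with \<open>x\<close> zeros, either the test result first or
  the allocation first, suggests the identity \<open>(n choose x) * (sum of likelihoods) = (n choose k) *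
  g a b n k x\<close>; it follows by comparing the two coefficients term by term
  (\<open>choose_mult_coeff_eq_choose_mult_g\<close>, \<open>sum_likelihood\<close>). If cell
  \<open>i\<close> is required to be empty, its factor becomes a constant and the other \<open>n -
  1\<close> cells give the same identity with \<open>n - 1\<close> for \<open>n\<close>
  (\<open>sum_likelihood_empty_cell\<close>). The quotient of the binomial coefficients of the two
  identities is the rational factor in \<open>\<alpha>\<^sup>-\<close> and
  \<open>\<alpha>\<^sup>+\<close>.
\<close>

section \<open>The distribution of the number of zeros as a polynomial coefficient\<close>

lemma pmf_add_pair_pmf:
  fixes p q :: "nat pmf"
  shows "pmf (map_pmf (\<lambda>(u, v). u + v) (pair_pmf p q)) x = (\<Sum>j\<le>x. pmf p j * pmf q (x - j))"
proof -
  have "(\<lambda>(u, v). u + v) -` {x} = (\<lambda>j. (j, x - j)) ` {..x}"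
    by (auto simp: image_iff)
  moreover have "inj_on (\<lambda>j. (j, x - j)) {..x}"
    by (auto simp: inj_on_def)
  ultimately show ?thesis
    by (simp add: pmf_map measure_measure_pmf_finite sum.reindex pmf_pair)
qed

text \<open>
  In contrast to \<open>coeff_linear_poly_power\<close>, also for \<open>j > m\<close>, so that coefficients of products
  can be compared term by term without regard to the range of summation.
\<close>

lemma coeff_binomial_power:
  fixes u v :: real
  shows "coeff ([:u, v:] ^ m) j = (m choose j) * v ^ j * u ^ (m - j)"
proof (cases "j \<le> m")
  case False
  then have "degree ([:u, v:] ^ m) < j"
    using degree_power_le[of "[:u, v:]" m] by (auto split: if_splits)
  then show ?thesis using False by (simp add: coeff_eq_0 binomial_eq_0)
qed (simp add: coeff_linear_poly_power)

text \<open>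
  The two factors are the probability generating functions of the two binomial distributions
  whose sum is the number of zeros.
\<close>

lemma g_eq_coeff:
  assumes "0 \<le> a" "a \<le> 1" "0 \<le> b" "b \<le> 1"
  shows "g a b m k x = coeff ([:a, 1 - a:] ^ k * [:1 - b, b:] ^ (m - k)) x"
  using assms
  by (simp add: g_def zeros_pmf_def pmf_add_pair_pmf coeff_mult coeff_binomial_power)

lemma coeff_binomial_power_mult:
  fixes c d e f :: real
  shows "coeff ([:c, d:] ^ p * [:e, f:] ^ q) r =
    (\<Sum>j\<le>r. (p choose j) * (q choose (r - j)) * (d ^ j * c ^ (p - j) * f ^ (r - j) * e ^ (q - (r - j))))"
  by (simp add: coeff_mult coeff_binomial_power mult_ac)

text \<open>
  Both sides count pairs of subsets of an \<open>n\<close>-set, of sizes \<open>x\<close> and \<open>k\<close>, that meet in \<open>j\<close>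
  elements: here the cells tested \<open>0\<close> and the cells with an object.
\<close>

lemma multinomial_symmetry:
  assumes "x \<le> n" "k \<le> n" "j \<le> x" "j \<le> k"
  shows "(n choose x) * ((x choose j) * ((n - x) choose (k - j)))
       = (n choose k) * ((k choose j) * ((n - k) choose (x - j)))"
proof -
  have split: "(n choose j) * ((n - j) choose (y - j)) = (n choose y) * (y choose j)"
    if "j \<le> y" "y \<le> n" for y
    using choose_mult[of j y n] that by simp
  have "((n - j) choose (x - j)) * ((n - x) choose (k - j))
      = ((n - j) choose (k - j)) * ((n - k) choose (x - j))"
  proof (cases "k - j \<le> n - x")
    case True
    have "((n - j) choose (x - j + (k - j))) * ((x - j + (k - j)) choose (x - j))
        = ((n - j) choose (x - j)) * ((n - x) choose (k - j))"
      using choose_mult[of "x - j" "x - j + (k - j)" "n - j"] assms True by simp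
    moreover have "((n - j) choose (x - j + (k - j))) * ((x - j + (k - j)) choose (k - j))
        = ((n - j) choose (k - j)) * ((n - k) choose (x - j))"
      using choose_mult[of "k - j" "x - j + (k - j)" "n - j"] assms True by simp
    ultimately show ?thesis
      using binomial_symmetric[of "x - j" "x - j + (k - j)"] by simp
  next
    case False
    then have "n - k < x - j" using assms by linarith
    then show ?thesis using False by (simp add: binomial_eq_0)
  qed
  then show ?thesis
    using split[of x] split[of k] assms by (metis mult.assoc)
qed

text \<open>
  Writing \<open>j\<close> for the number of objects in the cells tested \<open>0\<close>, the terms of the two coefficients
  contain the same powers of \<open>a\<close>, \<open>1 - a\<close>, \<open>b\<close> and \<open>1 - b\<close>, and their binomial coefficients
  are matched by \<open>multinomial_symmetry\<close>.
\<close>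

lemma choose_mult_coeff_eq_choose_mult_g:
  fixes a b :: real
  assumes "0 \<le> a" "a \<le> 1" "0 \<le> b" "b \<le> 1" and "x \<le> n" "k \<le> n"
  shows "(n choose x) * coeff ([:b, 1 - a:] ^ x * [:1 - b, a:] ^ (n - x)) k = (n choose k) * g a b n k x"
proof -
  let ?t = "\<lambda>j. (1 - a) ^ j * b ^ (x - j) * a ^ (k - j) * (1 - b) ^ (n - x - (k - j))"
  let ?u = "\<lambda>j. (1 - a) ^ j * a ^ (k - j) * b ^ (x - j) * (1 - b) ^ (n - k - (x - j))"
  have "(n choose x) * coeff ([:b, 1 - a:] ^ x * [:1 - b, a:] ^ (n - x)) k
      = (\<Sum>j\<le>k. real ((n choose x) * ((x choose j) * ((n - x) choose (k - j)))) * ?t j)"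
    by (simp add: coeff_binomial_power_mult sum_distrib_left mult_ac)
  also have "\<dots> = (\<Sum>j\<le>min k x. real ((n choose x) * ((x choose j) * ((n - x) choose (k - j)))) * ?t j)"
    by (rule sum.mono_neutral_right) (auto simp: binomial_eq_0)
  also have "\<dots> = (\<Sum>j\<le>min k x. real ((n choose k) * ((k choose j) * ((n - k) choose (x - j)))) * ?u j)"
  proof (rule sum.cong)
    fix j assume "j \<in> {..min k x}"
    then have j: "j \<le> k" "j \<le> x" by auto
    \<comment> \<open>Otherwise the exponents of \<open>1 - b\<close> may be truncated differently, but then both binomial coefficients vanish.\<close>
    have "?t j = ?u j" if "k - j \<le> n - x"
    proof -
      have "n - x - (k - j) = n - k - (x - j)" using that j assms by linarith
      then show ?thesis by (simp add: mult_ac)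
    qed
    then show "real ((n choose x) * ((x choose j) * ((n - x) choose (k - j)))) * ?t j
             = real ((n choose k) * ((k choose j) * ((n - k) choose (x - j)))) * ?u j"
      using multinomial_symmetry[of x n k j] j assms
      by (cases "k - j \<le> n - x") (auto simp: binomial_eq_0)
  qed simp
  also have "\<dots> = (\<Sum>j\<le>x. real ((n choose k) * ((k choose j) * ((n - k) choose (x - j)))) * ?u j)"
    by (rule sum.mono_neutral_left) (auto simp: binomial_eq_0)
  also have "\<dots> = (n choose k) * g a b n k x"
    using assms by (simp add: g_eq_coeff coeff_binomial_power_mult sum_distrib_left mult_ac)
  finally show ?thesis .
qed

section \<open>Sums of likelihoods over allocations\<close>

lemma finite_bit_vectors [simp]: "finite (bit_vectors n)"
  by (simp add: bit_vectors_def finite_PiE)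

lemma finite_allocations [simp]: "finite (allocations n k)"
  by (simp add: allocations_def)

lemma bit_vectors_cases:
  "\<gamma> \<in> bit_vectors n \<Longrightarrow> j \<in> {1..n} \<Longrightarrow> \<gamma> j = 0 \<or> \<gamma> j = 1"
  by (auto simp: bit_vectors_def PiE_iff)

text \<open>
  Expanding the product amounts to choosing \<open>\<gamma> j \<in> {0, 1}\<close> in every factor, and the power of the
  indeterminate records the number of ones chosen.
\<close>

lemma sum_allocations_prod_eq_coeff:
  fixes q :: "nat \<Rightarrow> nat \<Rightarrow> real"
  shows "(\<Sum>\<gamma>\<in>allocations n k. \<Prod>j=1..n. q j (\<gamma> j)) = coeff (\<Prod>j=1..n. [:q j 0, q j 1:]) k"
proof -
  have monom: "(\<Prod>j\<in>A. monom (c j) (e j)) = monom (\<Prod>j\<in>A. c j) (\<Sum>j\<in>A. e j)"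
    if "finite A" for A :: "nat set" and c :: "nat \<Rightarrow> real" and e
    using that by (induction A) (auto simp: mult_monom)
  have "(\<Prod>j=1..n. [:q j 0, q j 1:]) = (\<Prod>j=1..n. \<Sum>y\<in>{0, 1}. monom (q j y) y)"
    by (simp add: monom_altdef)
  also have "\<dots> = (\<Sum>\<gamma>\<in>bit_vectors n. \<Prod>j=1..n. monom (q j (\<gamma> j)) (\<gamma> j))"
    unfolding bit_vectors_def by (rule prod_sum_PiE) auto
  also have "\<dots> = (\<Sum>\<gamma>\<in>bit_vectors n. monom (\<Prod>j=1..n. q j (\<gamma> j)) (\<Sum>j=1..n. \<gamma> j))"
    by (simp add: monom)
  finally have "coeff (\<Prod>j=1..n. [:q j 0, q j 1:]) k
      = (\<Sum>\<gamma>\<in>bit_vectors n. if (\<Sum>j=1..n. \<gamma> j) = k then \<Prod>j=1..n. q j (\<gamma> j) else 0)"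
    by (simp only: coeff_sum coeff_monom)
  then show ?thesis
    by (simp add: allocations_def sum.inter_filter[symmetric])
qed

lemma card_allocations: "card (allocations n k) = n choose k"
proof -
  have "real (card (allocations n k)) = coeff ([:1, 1:] ^ n) k"
    using sum_allocations_prod_eq_coeff[of "\<lambda>_ _. 1" n k] by simp
  also have "\<dots> = n choose k"
    by (simp add: coeff_binomial_power)
  finally show ?thesis by simp
qed

definition test_prob :: "real \<Rightarrow> real \<Rightarrow> nat \<Rightarrow> nat \<Rightarrow> real" where
  "test_prob a b t r = (if t = 1 then (if r = 1 then a else 1 - a) else (if r = 0 then b else 1 - b))"

definition likelihood :: "real \<Rightarrow> real \<Rightarrow> nat \<Rightarrow> (nat \<Rightarrow> nat) \<Rightarrow> (nat \<Rightarrow> nat) \<Rightarrow> real" where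
  "likelihood a b n \<gamma> s = (\<Prod>j=1..n. test_prob a b (\<gamma> j) (s j))"

lemma test_prob_nonneg: "0 \<le> a \<Longrightarrow> a \<le> 1 \<Longrightarrow> 0 \<le> b \<Longrightarrow> b \<le> 1 \<Longrightarrow> 0 \<le> test_prob a b t r"
  by (simp add: test_prob_def)

lemma likelihood_nonneg: "0 \<le> a \<Longrightarrow> a \<le> 1 \<Longrightarrow> 0 \<le> b \<Longrightarrow> b \<le> 1 \<Longrightarrow> 0 \<le> likelihood a b n \<gamma> s"
  by (simp add: likelihood_def prod_nonneg test_prob_nonneg)

lemma num_zeros_eq_card:
  assumes "s \<in> bit_vectors n"
  shows "num_zeros n s = card {j \<in> {1..n}. s j = 0}"
proof -
  have "num_zeros n s = (\<Sum>j=1..n. if s j = 0 then 1 else 0)"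
    unfolding num_zeros_def using bit_vectors_cases[OF assms] by (intro sum.cong) force+
  then show ?thesis by (simp add: sum.If_cases Int_def)
qed

text \<open>
  Stated for any set of cells because it is used for all cells and for all cells but one.
\<close>

lemma prod_test_prob_poly:
  assumes "finite A" "\<And>j. j \<in> A \<Longrightarrow> s j = 0 \<or> s j = 1"
  shows "(\<Prod>j\<in>A. [:test_prob a b 0 (s j), test_prob a b 1 (s j):])
    = [:b, 1 - a:] ^ card {j \<in> A. s j = 0} * [:1 - b, a:] ^ (card A - card {j \<in> A. s j = 0})"
proof -
  have "(\<Prod>j\<in>A. [:test_prob a b 0 (s j), test_prob a b 1 (s j):])
      = (\<Prod>j\<in>A. if s j = 0 then [:b, 1 - a:] else [:1 - b, a:])"
    using assms(2) by (intro prod.cong refl) (fastforce simp: test_prob_def)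
  also have "\<dots> = [:b, 1 - a:] ^ card {j \<in> A. s j = 0} * [:1 - b, a:] ^ card (A - {j \<in> A. s j = 0})"
    using assms(1) by (simp add: prod.If_cases Int_def set_diff_eq Collect_neg_eq) (simp cong: conj_cong)
  also have "card (A - {j \<in> A. s j = 0}) = card A - card {j \<in> A. s j = 0}"
    using assms(1) by (intro card_Diff_subset) auto
  finally show ?thesis .
qed

lemma sum_likelihood:
  assumes "0 \<le> a" "a \<le> 1" "0 \<le> b" "b \<le> 1" and s: "s \<in> bit_vectors n" and "k \<le> n"
  shows "(n choose num_zeros n s) * (\<Sum>\<gamma>\<in>allocations n k. likelihood a b n \<gamma> s)
       = (n choose k) * g a b n k (num_zeros n s)"
proof -
  have "card {j \<in> {1..n}. s j = 0} \<le> card {1..n}"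
    by (intro card_mono) auto
  then have "num_zeros n s \<le> n" by (simp add: num_zeros_eq_card[OF s])
  moreover have "(\<Sum>\<gamma>\<in>allocations n k. likelihood a b n \<gamma> s)
      = coeff ([:b, 1 - a:] ^ num_zeros n s * [:1 - b, a:] ^ (n - num_zeros n s)) k"
    unfolding likelihood_def
    using sum_allocations_prod_eq_coeff[of "\<lambda>j t. test_prob a b t (s j)" n k]
      prod_test_prob_poly[of "{1..n}" s a b] bit_vectors_cases[OF s] num_zeros_eq_card[OF s] by simp
  ultimately show ?thesis
    using choose_mult_coeff_eq_choose_mult_g assms by simp
qed

text \<open>
  The condition \<open>\<gamma> i = 0\<close> is expressed by giving an object in cell \<open>i\<close> the weight \<open>0\<close>. This
  turns the linear factor of cell \<open>i\<close> into a constant and leaves the product for \<open>n - 1\<close> cells.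
\<close>

lemma sum_likelihood_empty_cell:
  assumes "0 \<le> a" "a \<le> 1" "0 \<le> b" "b \<le> 1" and s: "s \<in> bit_vectors n" and i: "i \<in> {1..n}" and "k < n"
    and y: "y = card {j \<in> {1..n} - {i}. s j = 0}"
  shows "((n - 1) choose y) * (\<Sum>\<gamma> | \<gamma> \<in> allocations n k \<and> \<gamma> i = 0. likelihood a b n \<gamma> s)
       = test_prob a b 0 (s i) * ((n - 1) choose k) * g a b (n - 1) k y"
proof -
  let ?q = "\<lambda>j t. if j = i \<and> t = 1 then 0 else test_prob a b t (s j)"
  have cardA: "card ({1..n} - {i}) = n - 1" using i by simp
  have "y \<le> n - 1"
    unfolding y cardA[symmetric] by (intro card_mono) auto
  have "(\<Sum>\<gamma> | \<gamma> \<in> allocations n k \<and> \<gamma> i = 0. likelihood a b n \<gamma> s)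
      = (\<Sum>\<gamma>\<in>allocations n k. if \<gamma> i = 0 then likelihood a b n \<gamma> s else 0)"
    by (simp add: sum.inter_filter)
  also have "\<dots> = (\<Sum>\<gamma>\<in>allocations n k. \<Prod>j=1..n. ?q j (\<gamma> j))"
  proof (rule sum.cong)
    fix \<gamma> assume "\<gamma> \<in> allocations n k"
    then have "\<gamma> i = 0 \<or> \<gamma> i = 1" using i bit_vectors_cases by (auto simp: allocations_def)
    then show "(if \<gamma> i = 0 then likelihood a b n \<gamma> s else 0) = (\<Prod>j=1..n. ?q j (\<gamma> j))"
      using i by (auto simp: likelihood_def intro!: prod.cong bexI[of _ i])
  qed simp
  also have "\<dots> = coeff (\<Prod>j=1..n. [:?q j 0, ?q j 1:]) k"
    by (rule sum_allocations_prod_eq_coeff)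
  also have "(\<Prod>j=1..n. [:?q j 0, ?q j 1:])
      = [:test_prob a b 0 (s i):] * (\<Prod>j\<in>{1..n} - {i}. [:test_prob a b 0 (s j), test_prob a b 1 (s j):])"
    using i by (simp add: prod.remove[of _ i])
  also have "(\<Prod>j\<in>{1..n} - {i}. [:test_prob a b 0 (s j), test_prob a b 1 (s j):])
      = [:b, 1 - a:] ^ y * [:1 - b, a:] ^ (n - 1 - y)"
    using prod_test_prob_poly[of "{1..n} - {i}" s a b] bit_vectors_cases[OF s] cardA by (simp add: y)
  finally show ?thesis
    using choose_mult_coeff_eq_choose_mult_g[of a b y "n - 1" k] \<open>y \<le> n - 1\<close> assms
    by simp
qed

text \<open>
  Treating both test results of cell \<open>i\<close> at once lets the probabilistic part of the argument be
  carried out only once.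
\<close>

definition alpha :: "nat \<Rightarrow> real \<Rightarrow> real \<Rightarrow> nat \<Rightarrow> nat \<Rightarrow> nat \<Rightarrow> real" where
  "alpha n a b r x k = (if r = 0 then alpha_minus n a b x k else alpha_plus n a b x k)"

text \<open>
  Removing cell \<open>i\<close> removes one zero if the cell was tested \<open>0\<close> and none if it was tested \<open>1\<close>.
  This is the origin of the arguments \<open>x - 1\<close> and \<open>x\<close> of \<open>g\<close> in \<open>alpha_minus\<close> and
  \<open>alpha_plus\<close>.
\<close>

lemma num_zeros_range:
  assumes s: "s \<in> bit_vectors n" and i: "i \<in> {1..n}"
  shows "s i = 0 \<Longrightarrow> num_zeros n s \<in> {1..n} \<and> card {j \<in> {1..n} - {i}. s j = 0} = num_zeros n s - 1"
    and "s i = 1 \<Longrightarrow> num_zeros n s \<in> {0..n - 1} \<and> card {j \<in> {1..n} - {i}. s j = 0} = num_zeros n s"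
proof -
  let ?Z = "{j \<in> {1..n}. s j = 0}" and ?Y = "{j \<in> {1..n} - {i}. s j = 0}"
  have Y: "?Y = ?Z - {i}" by auto
  have "card ?Y \<le> card ({1..n} - {i})" by (intro card_mono) auto
  then have le: "card ?Y \<le> n - 1" using i by simp
  {
    assume "s i = 0"
    then have "card ?Z = Suc (card ?Y)"
      unfolding Y using i by (intro card.remove) auto
    then show "num_zeros n s \<in> {1..n} \<and> card ?Y = num_zeros n s - 1"
      using le i by (auto simp: num_zeros_eq_card[OF s])
  next
    assume "s i = 1"
    then have "?Y = ?Z" by auto
    then show "num_zeros n s \<in> {0..n - 1} \<and> card ?Y = num_zeros n s"
      using le by (simp add: num_zeros_eq_card[OF s])
  }
qed

text \<open>
  In the main case \<open>k < n\<close> and \<open>g a b n k x \<noteq> 0\<close>, this is the quotient of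
  \<open>sum_likelihood_empty_cell\<close> and \<open>sum_likelihood\<close>. The conventions in the definitions of
  \<open>alpha_minus\<close> and \<open>alpha_plus\<close> agree with it in the other cases: for \<open>k = n\<close> no cell is
  empty, and if \<open>g a b n k x = 0\<close> then all likelihoods in the sums are \<open>0\<close>.
\<close>

lemma sum_likelihood_empty_cell_eq_alpha:
  assumes ab: "0 \<le> a" "a \<le> 1" "0 \<le> b" "b \<le> 1" and s: "s \<in> bit_vectors n" and i: "i \<in> {1..n}"
    and "k \<le> n"
  shows "(\<Sum>\<gamma> | \<gamma> \<in> allocations n k \<and> \<gamma> i = 0. likelihood a b n \<gamma> s)
       = alpha n a b (s i) (num_zeros n s) k * (\<Sum>\<gamma>\<in>allocations n k. likelihood a b n \<gamma> s)"
    (is "?E = _ * ?F")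
proof -
  define x where "x = num_zeros n s"
  have x: "x \<le> n"
    using num_zeros_range[OF s i] bit_vectors_cases[OF s i] by (auto simp: x_def)
  have W: "(n choose x) * ?F = (n choose k) * g a b n k x"
    using sum_likelihood[OF ab s \<open>k \<le> n\<close>] by (simp add: x_def)
  consider "g a b n k x = 0" | "k = n" | "g a b n k x \<noteq> 0" "k < n"
    using \<open>k \<le> n\<close> by linarith
  then show ?thesis
  proof cases
    case 1
    then have "?F = 0" using W x by simp
    moreover have "?E \<le> ?F"
      using likelihood_nonneg[OF ab] by (intro sum_mono2) auto
    moreover have "0 \<le> ?E"
      using likelihood_nonneg[OF ab] by (intro sum_nonneg) auto
    ultimately show ?thesis by simp
  next
    case 2
    have "\<gamma> i \<noteq> 0" if "\<gamma> \<in> allocations n n" for \<gamma>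
    proof
      assume "\<gamma> i = 0"
      have "\<gamma> j \<le> 1" if "j \<in> {1..n}" for j
        using bit_vectors_cases[of \<gamma> n j] \<open>\<gamma> \<in> allocations n n\<close> that by (auto simp: allocations_def)
      then have "(\<Sum>j=1..n. \<gamma> j) < (\<Sum>j=1..n. 1)"
        using i \<open>\<gamma> i = 0\<close> by (intro sum_strict_mono_ex1) (auto intro!: bexI[of _ i])
      then show False using that by (simp add: allocations_def)
    qed
    then have "?E = 0" using 2 by (intro sum.neutral) blast
    then show ?thesis using 2 by (simp add: alpha_def alpha_minus_def alpha_plus_def)
  next
    case 3
    have k: "(real n - real k) * (n choose k) = n * ((n - 1) choose k)"
      using arg_cong[OF binomial_absorb_comp[of n k], of real] \<open>k \<le> n\<close> by (simp add: of_nat_diff)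
    define y where "y = card {j \<in> {1..n} - {i}. s j = 0}"
    have y: "((n - 1) choose y) * ?E = test_prob a b 0 (s i) * ((n - 1) choose k) * g a b (n - 1) k y"
      by (rule sum_likelihood_empty_cell) (use assms 3 y_def in auto)
    have W': "?F = (n choose k) * g a b n k x / (n choose x)"
      using W x by (simp add: field_simps)
    have n: "n > 0" using i by simp
    have "s i = 0 \<or> s i = 1" using bit_vectors_cases[OF s i] .
    then show ?thesis
    proof
      assume si: "s i = 0"
      then have yx: "y = x - 1" "1 \<le> x" using num_zeros_range(1)[OF s i] by (auto simp: x_def y_def)
      have x1: "real x * (n choose x) = n * ((n - 1) choose (x - 1))"
        using arg_cong[OF times_binomial_minus1_eq[of x n], of real] yx by simp
      have pos: "((n - 1) choose (x - 1)) > 0" "(n choose x) > 0" using x yx by auto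
      have "?E = b * ((n - 1) choose k) * g a b (n - 1) k y / ((n - 1) choose (x - 1))"
        using y pos by (simp add: test_prob_def si yx field_simps)
      also have "\<dots> = b * (n * ((n - 1) choose k)) * g a b (n - 1) k y / (n * ((n - 1) choose (x - 1)))"
        using n by simp
      also have "\<dots> = b * ((real n - real k) * (n choose k)) * g a b (n - 1) k y / (real x * (n choose x))"
        by (simp only: x1 k)
      also have "\<dots> = alpha_minus n a b x k * ?F"
        using 3 yx by (simp add: W' alpha_minus_def)
      finally show ?thesis using si by (simp add: alpha_def x_def)
    next
      assume si: "s i = 1"
      then have yx: "y = x" "x \<le> n - 1" using num_zeros_range(2)[OF s i] by (auto simp: x_def y_def)
      have x1: "(real n - real x) * (n choose x) = n * ((n - 1) choose x)"
        using arg_cong[OF binomial_absorb_comp[of n x], of real] x by (simp add: of_nat_diff)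
      have pos: "((n - 1) choose x) > 0" "(n choose x) > 0" using x yx by auto
      have "?E = (1 - b) * ((n - 1) choose k) * g a b (n - 1) k y / ((n - 1) choose x)"
        using y pos by (simp add: test_prob_def si yx field_simps)
      also have "\<dots> = (1 - b) * (n * ((n - 1) choose k)) * g a b (n - 1) k y / (n * ((n - 1) choose x))"
        using n by simp
      also have "\<dots> = (1 - b) * ((real n - real k) * (n choose k)) * g a b (n - 1) k y
          / ((real n - real x) * (n choose x))"
        by (simp only: x1 k)
      also have "\<dots> = alpha_plus n a b x k * ?F"
        using 3 yx by (simp add: W' alpha_plus_def)
      finally show ?thesis using si by (simp add: alpha_def x_def)
    qed
  qed
qed

section \<open>Joint and posterior distributions\<close>

context test_and_find
begin

lemma a_unit: "0 \<le> a" "a \<le> 1" and b_unit: "0 \<le> b" "b \<le> 1"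
  using a_range b_range by auto

lemma K_range: "\<omega> \<in> space M \<Longrightarrow> K \<omega> \<le> n"
  using measurable_space[OF K_measurable] by auto

lemma T_range: "\<omega> \<in> space M \<Longrightarrow> T \<omega> \<in> bit_vectors n"
  using measurable_space[OF T_measurable] by auto

lemma S_range: "\<omega> \<in> space M \<Longrightarrow> S \<omega> \<in> bit_vectors n"
  using measurable_space[OF S_measurable] by auto

text \<open>
  All three variables take values in finite sets with the discrete \<open>\<sigma>\<close>-algebra, so every property
  of them is measurable.
\<close>

lemma pred_K_T_S [measurable]: "Measurable.pred M (\<lambda>\<omega>. P (K \<omega>) (T \<omega>) (S \<omega>))"
proof -
  have "(\<lambda>\<omega>. (K \<omega>, T \<omega>, S \<omega>)) \<in>
      M \<rightarrow>\<^sub>M count_space {0..n} \<Otimes>\<^sub>M (count_space (bit_vectors n) \<Otimes>\<^sub>M count_space (bit_vectors n))"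
    using K_measurable T_measurable S_measurable by (intro measurable_Pair)
  also have "count_space {0..n} \<Otimes>\<^sub>M (count_space (bit_vectors n) \<Otimes>\<^sub>M count_space (bit_vectors n))
      = count_space ({0..n} \<times> bit_vectors n \<times> bit_vectors n)"
    by (simp add: pair_measure_countable countable_finite)
  finally have "(\<lambda>\<omega>. (\<lambda>(k, t, s). P k t s) (K \<omega>, T \<omega>, S \<omega>)) \<in> M \<rightarrow>\<^sub>M count_space UNIV"
    by (rule measurable_compose) simp
  then show ?thesis by simp
qed

lemma events_K_T_S: "{\<omega> \<in> space M. P (K \<omega>) (T \<omega>) (S \<omega>)} \<in> events"
  using pred_K_T_S[of P] by (simp add: pred_def)

lemma prob_K_T:
  assumes \<gamma>: "\<gamma> \<in> bit_vectors n"
  shows "\<P>(\<omega> in M. K \<omega> = k \<and> T \<omega> = \<gamma>)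
       = (if \<gamma> \<in> allocations n k then \<P>(\<omega> in M. K \<omega> = k) / (n choose k) else 0)"
proof (cases "\<P>(\<omega> in M. K \<omega> = k) > 0")
  case True
  then obtain \<omega> where "\<omega> \<in> space M" "K \<omega> = k"
    using measure_empty[of M] by (metis (mono_tags, lifting) empty_Collect_eq less_irrefl)
  then have "k \<le> n" using K_range by blast
  then have ne: "allocations n k \<noteq> {}"
    using card_allocations[of n k] by force
  have "\<P>(\<omega> in M. T \<omega> = \<gamma> \<and> K \<omega> = k) / \<P>(\<omega> in M. K \<omega> = k)
      = indicator (allocations n k) \<gamma> / (n choose k)"
    using T_given_K[OF True \<gamma>] ne by (simp add: cond_prob_def card_allocations)
  then show ?thesis using True by (auto simp: conj_commute field_simps split: split_indicator)
next
  case False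
  moreover have "\<P>(\<omega> in M. K \<omega> = k \<and> T \<omega> = \<gamma>) \<le> \<P>(\<omega> in M. K \<omega> = k)"
    by (intro finite_measure_mono) (auto intro: events_K_T_S)
  ultimately show ?thesis
    using measure_nonneg[of M "{\<omega> \<in> space M. K \<omega> = k}"]
      measure_nonneg[of M "{\<omega> \<in> space M. K \<omega> = k \<and> T \<omega> = \<gamma>}"] by auto
qed

lemma prob_S_T:
  assumes pos: "\<P>(\<omega> in M. T \<omega> = \<gamma>) > 0" and \<gamma>: "\<gamma> \<in> bit_vectors n" and s: "s \<in> bit_vectors n"
  shows "\<P>(\<omega> in M. T \<omega> = \<gamma> \<and> S \<omega> = s) = \<P>(\<omega> in M. T \<omega> = \<gamma>) * likelihood a b n \<gamma> s"
proof -
  define N where "N = cond_space M (\<lambda>\<omega>. T \<omega> = \<gamma>)"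
  have [simp]: "space N = space M" "sets N = events" by (simp_all add: N_def)
  have meas_N: "measure N {\<omega> \<in> space M. P (S \<omega>)} = \<P>(\<omega> in M. P (S \<omega>) \<bar> T \<omega> = \<gamma>)" for P
    using measure_uniform_measure_eq_cond_prob[of "\<lambda>\<omega>. P (S \<omega>)" "\<lambda>\<omega>. T \<omega> = \<gamma>"]
    by (simp add: N_def)
  interpret N: prob_space N
    unfolding N_def using pos by (intro prob_space_uniform_measure) (auto simp: emeasure_eq_measure)
  have cell: "measure N {\<omega> \<in> space M. S \<omega> j = s j} = test_prob a b (\<gamma> j) (s j)" if j: "j \<in> {1..n}" for j
  proof -
    have compl: "measure N {\<omega> \<in> space M. S \<omega> j = 1} = 1 - measure N {\<omega> \<in> space M. S \<omega> j = 0}"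
    proof -
      have "{\<omega> \<in> space M. S \<omega> j = 1} = {\<omega> \<in> space N. \<not> S \<omega> j = 0}"
        using bit_vectors_cases[OF S_range j] by fastforce
      then show ?thesis
        using N.prob_neg[of "\<lambda>\<omega>. S \<omega> j = 0"] events_K_T_S[of "\<lambda>_ _ s. s j = 0"] by simp
    qed
    have one: "measure N {\<omega> \<in> space M. S \<omega> j = 1} = a" if "\<gamma> j = 1"
      using S_one_given_T[OF pos j that] meas_N[of "\<lambda>s. s j = 1"] by simp
    have zero: "measure N {\<omega> \<in> space M. S \<omega> j = 0} = b" if "\<gamma> j = 0"
      using S_zero_given_T[OF pos j that] meas_N[of "\<lambda>s. s j = 0"] by simp
    show ?thesis
      using bit_vectors_cases[OF \<gamma> j] bit_vectors_cases[OF s j] compl one zero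
      by (auto simp: test_prob_def)
  qed
  \<comment> \<open>Bit vectors are extensional, so \<open>S \<omega> = s\<close> amounts to equality on the \<open>n\<close> independent cells.\<close>
  have "{\<omega> \<in> space M. S \<omega> = s} = (\<Inter>j\<in>{1..n}. (\<lambda>\<omega>. S \<omega> j) -` {s j} \<inter> space N)" (is "?L = ?R")
  proof
    show "?R \<subseteq> ?L"
    proof
      fix \<omega> assume \<omega>: "\<omega> \<in> ?R"
      then have "\<omega> \<in> space M" using n_pos by auto
      moreover have "S \<omega> = s"
        using S_range[OF \<open>\<omega> \<in> space M\<close>] s \<omega> unfolding bit_vectors_def by (intro PiE_ext) auto
      ultimately show "\<omega> \<in> ?L" by simp
    qed
  qed (use n_pos in auto)
  then have "measure N {\<omega> \<in> space M. S \<omega> = s}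
      = (\<Prod>j=1..n. measure N ((\<lambda>\<omega>. S \<omega> j) -` {s j} \<inter> space N))"
    using N.indep_varsD_finite[of "\<lambda>_. count_space {0, 1}" "\<lambda>j \<omega>. S \<omega> j" "{1..n}" "\<lambda>j. {s j}"]
      S_indep_given_T[OF pos] n_pos bit_vectors_cases[OF s] by (auto simp: N_def)
  also have "\<dots> = likelihood a b n \<gamma> s"
    unfolding likelihood_def
    by (intro prod.cong) (simp_all add: cell[symmetric] vimage_def Int_def conj_commute)
  finally show ?thesis
    using pos meas_N[of "\<lambda>t. t = s"] by (simp add: cond_prob_def conj_commute field_simps)
qed

text \<open>
  The likelihood is known only given \<open>T = \<gamma>\<close>, not given \<open>K\<close> and \<open>T\<close> jointly. But \<open>K\<close> is almost
  surely the number of ones of \<open>T\<close>, so that adding \<open>K = k\<close> to the condition \<open>T = \<gamma>\<close> changes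
  nothing if \<open>\<gamma>\<close> has \<open>k\<close> ones and gives a null event otherwise.
\<close>

lemma prob_K_T_S:
  assumes \<gamma>: "\<gamma> \<in> bit_vectors n" and s: "s \<in> bit_vectors n"
  shows "\<P>(\<omega> in M. K \<omega> = k \<and> T \<omega> = \<gamma> \<and> S \<omega> = s)
       = (if \<gamma> \<in> allocations n k then \<P>(\<omega> in M. K \<omega> = k) / (n choose k) * likelihood a b n \<gamma> s else 0)"
proof -
  have le: "\<P>(\<omega> in M. K \<omega> = k' \<and> T \<omega> = \<gamma> \<and> S \<omega> = s) \<le> \<P>(\<omega> in M. K \<omega> = k' \<and> T \<omega> = \<gamma>)" for k'
    by (intro finite_measure_mono) (auto intro: events_K_T_S)
  then have null: "\<P>(\<omega> in M. K \<omega> = k' \<and> T \<omega> = \<gamma> \<and> S \<omega> = s) = 0" if "\<gamma> \<notin> allocations n k'" for k'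
    using prob_K_T[OF \<gamma>, of k'] that measure_nonneg by (metis (mono_tags, lifting) order_antisym)
  show ?thesis
  proof (cases "\<gamma> \<in> allocations n k")
    case False
    then show ?thesis using null by simp
  next
    case True
    then have other: "\<gamma> \<notin> allocations n k'" if "k' \<noteq> k" for k'
      using that by (auto simp: allocations_def)
    have "(\<Sum>j=1..n. \<gamma> j) \<le> (\<Sum>j=1..n. 1)"
      using bit_vectors_cases[OF \<gamma>] by (intro sum_mono) force
    then have "k \<in> {0..n}" using True by (simp add: allocations_def)
    have collapse: "(\<Sum>k'=0..n. f k') = f k" if "\<And>k'. k' \<noteq> k \<Longrightarrow> f k' = 0" for f :: "nat \<Rightarrow> real"
      using \<open>k \<in> {0..n}\<close> that by (subst sum.mono_neutral_right[of _ "{k}"]) auto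
    have "\<P>(\<omega> in M. T \<omega> = \<gamma>) = (\<Sum>k'=0..n. \<P>(\<omega> in M. K \<omega> = k' \<and> T \<omega> = \<gamma>))"
      using K_range by (intro prob_sum) (auto intro: events_K_T_S)
    also have "\<dots> = \<P>(\<omega> in M. K \<omega> = k) / (n choose k)"
      using other True by (subst collapse) (simp_all add: prob_K_T[OF \<gamma>])
    finally have T: "\<P>(\<omega> in M. T \<omega> = \<gamma>) = \<P>(\<omega> in M. K \<omega> = k) / (n choose k)" .
    have "\<P>(\<omega> in M. T \<omega> = \<gamma> \<and> S \<omega> = s) = (\<Sum>k'=0..n. \<P>(\<omega> in M. K \<omega> = k' \<and> T \<omega> = \<gamma> \<and> S \<omega> = s))"
      using K_range by (intro prob_sum) (auto intro: events_K_T_S)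
    also have "\<dots> = \<P>(\<omega> in M. K \<omega> = k \<and> T \<omega> = \<gamma> \<and> S \<omega> = s)"
      using other null by (intro collapse) simp
    finally have TS: "\<P>(\<omega> in M. K \<omega> = k \<and> T \<omega> = \<gamma> \<and> S \<omega> = s) = \<P>(\<omega> in M. T \<omega> = \<gamma> \<and> S \<omega> = s)" ..
    show ?thesis
    proof (cases "\<P>(\<omega> in M. T \<omega> = \<gamma>) > 0")
      case True
      then show ?thesis
        using prob_S_T[OF True \<gamma> s] TS T \<open>\<gamma> \<in> allocations n k\<close> by simp
    next
      case False
      then have "\<P>(\<omega> in M. T \<omega> = \<gamma>) = 0"
        using measure_nonneg[of M "{\<omega> \<in> space M. T \<omega> = \<gamma>}"] by linarith
      moreover have "\<P>(\<omega> in M. T \<omega> = \<gamma> \<and> S \<omega> = s) \<le> \<P>(\<omega> in M. T \<omega> = \<gamma>)"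
        by (intro finite_measure_mono) (auto intro: events_K_T_S)
      ultimately have "\<P>(\<omega> in M. T \<omega> = \<gamma> \<and> S \<omega> = s) = 0"
        using measure_nonneg[of M "{\<omega> \<in> space M. T \<omega> = \<gamma> \<and> S \<omega> = s}"] by linarith
      then show ?thesis
        unfolding T[symmetric] TS
        using \<open>\<P>(\<omega> in M. T \<omega> = \<gamma>) = 0\<close> \<open>\<gamma> \<in> allocations n k\<close> by simp
    qed
  qed
qed

text \<open>
  For \<open>Q\<close> saying that cell \<open>i\<close> is empty and for trivial \<open>Q\<close>, these are the numerator and the
  denominator of Bayes' rule. The factor in front of the sum does not depend on \<open>Q\<close> and cancels.
\<close>

lemma prob_K_pred_T_S:
  assumes s: "s \<in> bit_vectors n"
  shows "\<P>(\<omega> in M. K \<omega> = k \<and> Q (T \<omega>) \<and> S \<omega> = s)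
       = \<P>(\<omega> in M. K \<omega> = k) / (n choose k) * (\<Sum>\<gamma> | \<gamma> \<in> allocations n k \<and> Q \<gamma>. likelihood a b n \<gamma> s)"
proof -
  have "\<P>(\<omega> in M. K \<omega> = k \<and> Q (T \<omega>) \<and> S \<omega> = s)
      = (\<Sum>\<gamma> | \<gamma> \<in> bit_vectors n \<and> Q \<gamma>. \<P>(\<omega> in M. K \<omega> = k \<and> T \<omega> = \<gamma> \<and> S \<omega> = s))"
    using T_range by (intro prob_sum) (auto intro: events_K_T_S)
  also have "\<dots> = (\<Sum>\<gamma> | \<gamma> \<in> allocations n k \<and> Q \<gamma>. \<P>(\<omega> in M. K \<omega> = k \<and> T \<omega> = \<gamma> \<and> S \<omega> = s))"
    by (rule sum.mono_neutral_right) (auto simp: prob_K_T_S[OF _ s] allocations_def)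
  also have "\<dots> = (\<Sum>\<gamma> | \<gamma> \<in> allocations n k \<and> Q \<gamma>.
      \<P>(\<omega> in M. K \<omega> = k) / (n choose k) * likelihood a b n \<gamma> s)"
    by (rule sum.cong) (auto simp: prob_K_T_S[OF _ s] allocations_def)
  finally show ?thesis by (simp add: sum_distrib_left)
qed

lemma prob_empty_cell_K_S:
  assumes s: "s \<in> bit_vectors n" and i: "i \<in> {1..n}" and "k \<le> n"
  shows "\<P>(\<omega> in M. K \<omega> = k \<and> T \<omega> i = 0 \<and> S \<omega> = s)
       = alpha n a b (s i) (num_zeros n s) k * \<P>(\<omega> in M. K \<omega> = k \<and> S \<omega> = s)"
  using prob_K_pred_T_S[OF s, of k "\<lambda>\<gamma>. \<gamma> i = 0"] prob_K_pred_T_S[OF s, of k "\<lambda>_. True"]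
    sum_likelihood_empty_cell_eq_alpha[OF a_unit b_unit s i \<open>k \<le> n\<close>]
  by simp

text \<open>
  \<open>K\<close> takes finitely many values, so \<open>f (K \<omega>)\<close> is a finite combination of indicators of the
  events \<open>K = k\<close>.
\<close>

lemma cond_expect_K:
  assumes pos: "\<P>(\<omega> in M. S \<omega> = s) > 0"
  shows "cond_expect M (\<lambda>\<omega>. f (K \<omega>)) (\<lambda>\<omega>. S \<omega> = s) = (\<Sum>k=0..n. f k * \<P>(\<omega> in M. K \<omega> = k \<bar> S \<omega> = s))"
proof -
  let ?N = "cond_space M (\<lambda>\<omega>. S \<omega> = s)"
  interpret N: prob_space ?N
    using pos by (intro prob_space_uniform_measure) (auto simp: emeasure_eq_measure)
  have ev: "{\<omega> \<in> space M. K \<omega> = k} \<in> sets ?N" for k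
    by (simp add: events_K_T_S)
  have "cond_expect M (\<lambda>\<omega>. f (K \<omega>)) (\<lambda>\<omega>. S \<omega> = s)
      = (\<integral>\<omega>. (\<Sum>k=0..n. f k * indicator {\<omega> \<in> space M. K \<omega> = k} \<omega>) \<partial>?N)"
    unfolding cond_expect_def
  proof (rule Bochner_Integration.integral_cong)
    fix \<omega> assume "\<omega> \<in> space ?N"
    then have "\<omega> \<in> space M" "K \<omega> \<in> {0..n}" using K_range by auto
    then show "f (K \<omega>) = (\<Sum>k=0..n. f k * indicator {\<omega> \<in> space M. K \<omega> = k} \<omega>)"
      by (subst sum.mono_neutral_right[of _ "{K \<omega>}"]) (auto simp: indicator_def)
  qed simp
  also have "\<dots> = (\<Sum>k=0..n. \<integral>\<omega>. f k * indicator {\<omega> \<in> space M. K \<omega> = k} \<omega> \<partial>?N)"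
    using ev by (intro Bochner_Integration.integral_sum integrable_mult_right integrable_real_indicator)
      (auto simp: N.emeasure_eq_measure)
  also have "\<dots> = (\<Sum>k=0..n. f k * measure ?N {\<omega> \<in> space M. K \<omega> = k})"
    by (simp add: Int_def cong: conj_cong)
  also have "\<dots> = (\<Sum>k=0..n. f k * \<P>(\<omega> in M. K \<omega> = k \<bar> S \<omega> = s))"
    using measure_uniform_measure_eq_cond_prob[of "\<lambda>\<omega>. K \<omega> = _" "\<lambda>\<omega>. S \<omega> = s"] by simp
  finally show ?thesis .
qed

lemma cond_prob_empty_cell:
  assumes s: "s \<in> bit_vectors n" and i: "i \<in> {1..n}"
  shows "\<P>(\<omega> in M. T \<omega> i = 0 \<bar> S \<omega> = s)
       = (\<Sum>k=0..n. alpha n a b (s i) (num_zeros n s) k * \<P>(\<omega> in M. K \<omega> = k \<bar> S \<omega> = s))"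
proof -
  have "\<P>(\<omega> in M. T \<omega> i = 0 \<and> S \<omega> = s) = (\<Sum>k=0..n. \<P>(\<omega> in M. K \<omega> = k \<and> T \<omega> i = 0 \<and> S \<omega> = s))"
    using K_range by (intro prob_sum) (auto intro: events_K_T_S)
  also have "\<dots> = (\<Sum>k=0..n. alpha n a b (s i) (num_zeros n s) k * \<P>(\<omega> in M. K \<omega> = k \<and> S \<omega> = s))"
    using prob_empty_cell_K_S[OF s i] by (intro sum.cong) auto
  finally show ?thesis
    by (simp add: cond_prob_def sum_divide_distrib)
qed

end

theorem proposition5:
  fixes M :: "'w measure" and n :: nat and a b :: real
    and K :: "'w \<Rightarrow> nat" and T S :: "'w \<Rightarrow> nat \<Rightarrow> nat"
    and i x :: nat and s :: "nat \<Rightarrow> nat"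
  assumes "test_and_find M n a b K T S"
    and "i \<in> {1..n}"
    and "s \<in> bit_vectors n"
    and "\<P>(\<omega> in M. S \<omega> = s) > 0"
    and "x = num_zeros n s"
  shows "(s i = 0 \<longrightarrow>
            x \<in> {1..n} \<and>
            \<P>(\<omega> in M. T \<omega> i = 0 \<bar> S \<omega> = s)
              = cond_expect M (\<lambda>\<omega>. alpha_minus n a b x (K \<omega>)) (\<lambda>\<omega>. S \<omega> = s) \<and>
            cond_expect M (\<lambda>\<omega>. alpha_minus n a b x (K \<omega>)) (\<lambda>\<omega>. S \<omega> = s)
              = (\<Sum>k=0..n. alpha_minus n a b x k * \<P>(\<omega> in M. K \<omega> = k \<bar> S \<omega> = s))) \<and>
         (s i = 1 \<longrightarrow>
            x \<in> {0..n - 1} \<and>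
            \<P>(\<omega> in M. T \<omega> i = 0 \<bar> S \<omega> = s)
              = cond_expect M (\<lambda>\<omega>. alpha_plus n a b x (K \<omega>)) (\<lambda>\<omega>. S \<omega> = s) \<and>
            cond_expect M (\<lambda>\<omega>. alpha_plus n a b x (K \<omega>)) (\<lambda>\<omega>. S \<omega> = s)
              = (\<Sum>k=0..n. alpha_plus n a b x k * \<P>(\<omega> in M. K \<omega> = k \<bar> S \<omega> = s)))"
proof -
  interpret test_and_find M n a b K T S by fact
  note E = cond_expect_K[OF assms(4)]
  note P = cond_prob_empty_cell[OF assms(3,2)]
  show ?thesis
  proof (intro conjI impI)
    assume "s i = 0"
    then show "x \<in> {1..n}"
      using num_zeros_range(1)[OF assms(3,2)] assms(5) by simp
    show "\<P>(\<omega> in M. T \<omega> i = 0 \<bar> S \<omega> = s)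
        = cond_expect M (\<lambda>\<omega>. alpha_minus n a b x (K \<omega>)) (\<lambda>\<omega>. S \<omega> = s)"
      unfolding E[of "alpha_minus n a b x"] using P \<open>s i = 0\<close> by (simp add: alpha_def assms(5))
  next
    assume "s i = 1"
    then show "x \<in> {0..n - 1}"
      using num_zeros_range(2)[OF assms(3,2)] assms(5) by simp
    show "\<P>(\<omega> in M. T \<omega> i = 0 \<bar> S \<omega> = s)
        = cond_expect M (\<lambda>\<omega>. alpha_plus n a b x (K \<omega>)) (\<lambda>\<omega>. S \<omega> = s)"
      unfolding E[of "alpha_plus n a b x"] using P \<open>s i = 1\<close> by (simp add: alpha_def assms(5))
  qed (rule E)+
qed

end
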